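(* If $f(z)=z+\sum_{n=2}^{\infty}a_nz^n\in \mathcal{S}_{S,L}^*$, then $$|H_{2,2}(f)|=|a_2a_4-a_3^2|\leq\frac{1}{16}\quad\text{and}\quad |H_{2,2}(f^{-1})|=|A_2A_4-A_3^2|\leq\frac{1}{16}.$$ The inequalities are sharp.
   Context: $\mathbb{D}=\{z\in\mathbb{C}:|z|<1\}$. $\mathcal{S}$ is the class of univalent (injective) analytic functions $f$ on $\mathbb{D}$ with expansion $f(z)=z+\sum_{n\ge 2}a_nz^n$. For analytic $g,h$ on $\mathbb{D}$, $g\prec h$ (subordination) means $g=h\circ w$ for some analytic $w:\mathbb{D}\to\mathbb{D}$ with $w(0)=0$. The class is $$\mathcal{S}_{S,L}^*=\left\{f\in\mathcal{S}:\ \frac{2zf'(z)}{f(z)-f(-z)}\prec \sqrt{1+z}\right\}$$ (principal branch of the square root). For $f\in\mathcal{S}$, the inverse function near $0$ is $f^{-1}(w)=w+A_2w^2+A_3w^3+A_4w^4+\cdots$. Set $H_{2,2}(f):=a_2a_4-a_3^2$ and $H_{2,2}(f^{-1}):=A_2A_4-A_3^2$. "Sharp" means that, for each of the two inequalities, equality is attained by some function in the class. *)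

theory Defs
  imports "HOL-Complex_Analysis.Complex_Analysis"
begin

abbreviation unit_disc :: "complex set" where
  "unit_disc \<equiv> ball 0 1"

definition class_S :: "(complex \<Rightarrow> complex) set" where
  "class_S = {f. f holomorphic_on unit_disc \<and> inj_on f unit_disc \<and> f 0 = 0 \<and> deriv f 0 = 1}"

text \<open>For \<open>h\<close> analytic on the disc, analyticity of \<open>g\<close> follows from the existence of \<open>w\<close>.\<close>

definition subordinate :: "(complex \<Rightarrow> complex) \<Rightarrow> (complex \<Rightarrow> complex) \<Rightarrow> bool"
    (infix "\<prec>\<^sub>s" 50) where
  "g \<prec>\<^sub>s h \<longleftrightarrow>
     (\<exists>w. w holomorphic_on unit_disc \<and> w ` unit_disc \<subseteq> unit_disc \<and> w 0 = 0 \<and>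
          (\<forall>z\<in>unit_disc. g z = h (w z)))"

text \<open>The quotient \<open>2 z f'(z) / (f(z) - f(-z))\<close> has a removable singularity at the origin. For
  \<open>f\<close> in \<open>class_S\<close> its limit there is 1 (lemma \<open>sym_quotient_tendsto\<close>), and elsewhere in the disc
  the denominator is nonzero because \<open>f\<close> is injective.\<close>

definition sym_quotient :: "(complex \<Rightarrow> complex) \<Rightarrow> complex \<Rightarrow> complex" where
  "sym_quotient f z = (if z = 0 then 1 else 2 * z * deriv f z / (f z - f (- z)))"

lemma sym_quotient_tendsto:
  assumes "f \<in> class_S"
  shows "((\<lambda>z. 2 * z * deriv f z / (f z - f (- z))) \<longlongrightarrow> 1) (at 0)"
proof -
  have hol: "f holomorphic_on unit_disc" and f0: "f 0 = 0" and d0: "deriv f 0 = 1"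
    using assms by (auto simp: class_S_def)
  have der: "(f has_field_derivative 1) (at 0)"
    using holomorphic_derivI[OF hol, of 0] d0 by simp
  have derm: "((\<lambda>z. f (- z)) has_field_derivative - 1) (at 0)"
    using DERIV_chain2[of f 1 uminus 0 "- 1" UNIV] der by (simp add: DERIV_minus)
  have "((\<lambda>z. f z - f (- z)) has_field_derivative 2) (at 0)"
    using DERIV_diff[OF der derm] by simp
  then have q: "((\<lambda>z. (f z - f (- z)) / z) \<longlongrightarrow> 2) (at 0)"
    by (simp add: has_field_derivative_iff f0)
  have "deriv f holomorphic_on unit_disc"
    using hol by (rule holomorphic_deriv) simp
  then have "isCont (deriv f) 0"
    using holomorphic_on_imp_continuous_on continuous_on_eq_continuous_at[of unit_disc "deriv f"]
    by force
  then have "(deriv f \<longlongrightarrow> 1) (at 0)"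
    using d0 by (simp add: isCont_def)
  then have "((\<lambda>z. 2 * deriv f z / ((f z - f (- z)) / z)) \<longlongrightarrow> 2 * 1 / 2) (at 0)"
    using q by (intro tendsto_intros) auto
  moreover have "(\<lambda>z. 2 * deriv f z / ((f z - f (- z)) / z)) =
      (\<lambda>z. 2 * z * deriv f z / (f z - f (- z)))"
    by (auto simp: fun_eq_iff)
  ultimately show ?thesis by simp
qed

definition class_SSL :: "(complex \<Rightarrow> complex) set" where
  "class_SSL = {f \<in> class_S. sym_quotient f \<prec>\<^sub>s (\<lambda>z. csqrt (1 + z))}"

definition hankel22 :: "(complex \<Rightarrow> complex) \<Rightarrow> complex" where
  "hankel22 f = (let a = fps_nth (fps_expansion f 0) in a 2 * a 4 - (a 3)\<^sup>2)"

text \<open>The inverse of an injective \<open>f\<close> is meaningful on the open set \<open>f ` unit_disc\<close>, a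
  neighbourhood of \<open>f 0 = 0\<close>.\<close>

definition disc_inv :: "(complex \<Rightarrow> complex) \<Rightarrow> complex \<Rightarrow> complex" where
  "disc_inv f = the_inv_into unit_disc f"

end

theory Submission
  imports Defs
begin

text \<open>Write the Schwarz function as \<open>w(z) = b\<^sub>1 z + b\<^sub>2 z\<^sup>2 + b\<^sub>3 z\<^sup>3 + \<dots>\<close>. Comparing coefficients in
  \<open>2 z f'(z) = (f(z) - f(-z)) \<surd>(1 + w(z))\<close> turns both Hankel determinants into
  \<open>b\<^sub>1 b\<^sub>3/32 + p b\<^sub>1\<^sup>2 b\<^sub>2 + q b\<^sub>1\<^sup>4 - b\<^sub>2\<^sup>2/16\<close> with small \<open>p\<close>, \<open>q\<close>. The Schur algorithm
  bounds \<open>\<bar>b\<^sub>2\<bar>\<close> and \<open>\<bar>b\<^sub>3\<bar>\<close>, and then the triangle inequality suffices, the maximum being reached at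
  \<open>b\<^sub>1 = 0\<close>, \<open>\<bar>b\<^sub>2\<bar> = 1\<close>. The extremal function for \<open>w(z) = z\<^sup>2\<close> is, with \<open>s = \<surd>(1 + z\<^sup>2)\<close>,
  \<open>f(z) = 2 z e\<^bsup>s-1\<^esup>/(1 + s)\<close>; it satisfies \<open>z f'/f = s\<close>, and it is univalent because
  \<open>Re f' > 0\<close>.\<close>

text \<open>Passes from an identity of functions near 0 to one of formal power series; every
  coefficient comparison below rests on it.\<close>

lemma has_fps_expansion_eqI:
  fixes f g :: "complex \<Rightarrow> complex"
  assumes "f has_fps_expansion F" "g has_fps_expansion G"
    and "open A" "0 \<in> A" "\<And>z. z \<in> A \<Longrightarrow> f z = g z"
  shows "F = G"
proof -
  have "eventually (\<lambda>z. f z = g z) (nhds 0)"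
    using assms(3-5) eventually_nhds by blast
  then have "g has_fps_expansion F"
    using has_fps_expansion_cong[of f g F F] assms(1) by simp
  then show ?thesis
    using assms(2) fps_expansion_unique_complex by blast
qed

section \<open>The Schur algorithm\<close>

text \<open>A Moebius map moves \<phi>(0) to 0, and the Schwarz lemma then lets one factor z be
  divided out. The relation is stated multiplied out because its denominator vanishes when \<phi> is
  a unimodular constant.\<close>

lemma schur_step:
  assumes hol: "\<phi> holomorphic_on ball 0 1" and le1: "\<And>z. z \<in> ball 0 1 \<Longrightarrow> cmod (\<phi> z) \<le> 1"
  obtains \<omega> where "\<omega> holomorphic_on ball 0 1" "\<And>z. z \<in> ball 0 1 \<Longrightarrow> cmod (\<omega> z) \<le> 1"
    "\<And>z. z \<in> ball 0 1 \<Longrightarrow> \<phi> z - \<phi> 0 = z * \<omega> z * (1 - cnj (\<phi> 0) * \<phi> z)"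
proof (cases "\<exists>\<xi>\<in>ball 0 1. cmod (\<phi> \<xi>) = 1")
  \<comment> \<open>The Moebius map needs |\<phi>(0)| < 1. If modulus 1 is attained, the maximum
    principle makes \<phi> constant and \<omega> = 0 serves.\<close>
  case True
  then obtain \<xi> where \<xi>: "\<xi> \<in> ball 0 1" "cmod (\<phi> \<xi>) = 1" by blast
  have "\<phi> constant_on ball 0 1"
    using hol by (rule maximum_modulus_principle[where U="ball 0 1" and \<xi>=\<xi>])
      (use \<xi> le1 in auto)
  then obtain c where "\<And>z. z \<in> ball 0 1 \<Longrightarrow> \<phi> z = c"
    by (auto simp: constant_on_def)
  then show ?thesis
    by (intro that[of "\<lambda>_. 0"]) auto
next
  case False
  then have lt1: "cmod (\<phi> z) < 1" if "z \<in> ball 0 1" for z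
    using le1[OF that] that by fastforce
  define b where "b = \<phi> 0"
  have b: "cmod b < 1" using lt1[of 0] by (simp add: b_def)
  define \<psi> where "\<psi> = Moebius_function 0 b \<circ> \<phi>"
  have nz: "1 - cnj b * \<phi> z \<noteq> 0" if "z \<in> ball 0 1" for z
  proof -
    have "cmod (cnj b * \<phi> z) < 1"
      using b lt1[OF that] norm_mult_less[of "cnj b" 1 "\<phi> z" 1] by simp
    then show ?thesis by auto
  qed
  have \<psi>_hol: "\<psi> holomorphic_on ball 0 1" unfolding \<psi>_def
    using hol Moebius_function_holomorphic[OF b]
    by (rule holomorphic_on_compose_gen) (use lt1 in auto)
  have \<psi>0: "\<psi> 0 = 0" by (simp add: \<psi>_def b_def Moebius_function_eq_zero)
  have \<psi>_lt: "cmod (\<psi> z) < 1" if "cmod z < 1" for z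
    unfolding \<psi>_def o_def using that lt1 b by (intro Moebius_function_norm_lt_1) auto
  \<comment> \<open>The value at 0 removes the singularity of \<psi>(z)/z; the derivative part of
    the Schwarz lemma bounds it.\<close>
  define \<omega> where "\<omega> = (\<lambda>z. if z = 0 then deriv \<psi> 0 else (\<psi> z - \<psi> 0) / (z - 0))"
  show ?thesis
  proof (rule that)
    show "\<omega> holomorphic_on ball 0 1"
      unfolding \<omega>_def by (rule pole_lemma_open[OF \<psi>_hol]) simp
    show "cmod (\<omega> z) \<le> 1" if "z \<in> ball 0 1" for z
      using Schwarz_Lemma(1,2)[OF \<psi>_hol \<psi>0 \<psi>_lt, of z] that \<psi>0
      by (auto simp: \<omega>_def norm_divide divide_le_eq)
    show "\<phi> z - \<phi> 0 = z * \<omega> z * (1 - cnj (\<phi> 0) * \<phi> z)" if "z \<in> ball 0 1" for z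
    proof -
      have "z * \<omega> z = \<psi> z" using \<psi>0 by (simp add: \<omega>_def)
      also have "\<dots> = (\<phi> z - b) / (1 - cnj b * \<phi> z)"
        by (simp add: \<psi>_def Moebius_function_simple)
      finally show ?thesis using nz[OF that] by (simp add: b_def)
    qed
  qed
qed

lemma schur_step_fps:
  assumes hol: "\<phi> holomorphic_on ball 0 1" and le1: "\<And>z. z \<in> ball 0 1 \<Longrightarrow> cmod (\<phi> z) \<le> 1"
    and F: "\<phi> has_fps_expansion F"
  obtains \<omega> C where "\<omega> holomorphic_on ball 0 1" "\<And>z. z \<in> ball 0 1 \<Longrightarrow> cmod (\<omega> z) \<le> 1"
    "\<omega> has_fps_expansion C" "\<phi> 0 = fps_nth F 0"
    "F - fps_const (fps_nth F 0) = fps_X * C * (1 - fps_const (cnj (fps_nth F 0)) * F)"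
proof -
  obtain \<omega> where \<omega>: "\<omega> holomorphic_on ball 0 1" "\<And>z. z \<in> ball 0 1 \<Longrightarrow> cmod (\<omega> z) \<le> 1"
    "\<And>z. z \<in> ball 0 1 \<Longrightarrow> \<phi> z - \<phi> 0 = z * \<omega> z * (1 - cnj (\<phi> 0) * \<phi> z)"
    using schur_step[OF hol le1] by blast
  have C: "\<omega> has_fps_expansion fps_expansion \<omega> 0"
    using \<omega>(1) by (intro has_fps_expansion_fps_expansion[of "ball 0 1"]) auto
  have F0: "\<phi> 0 = fps_nth F 0"
    using has_fps_expansion_imp_0_eq_fps_nth_0[OF F] .
  have "F - fps_const (\<phi> 0) = fps_X * fps_expansion \<omega> 0 * (1 - fps_const (cnj (\<phi> 0)) * F)"
    by (rule has_fps_expansion_eqI[of "\<lambda>z. \<phi> z - \<phi> 0" _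
          "\<lambda>z. z * \<omega> z * (1 - cnj (\<phi> 0) * \<phi> z)" _ "ball 0 1"])
      (use \<omega>(3) in \<open>auto intro!: fps_expansion_intros F C\<close>)
  with \<omega>(1,2) C F0 show ?thesis by (intro that) auto
qed

text \<open>Two Schur steps, \<phi> to \<omega> to \<rho>, with t = |\<omega>(0)|. The modulus of
  the first coefficient is kept as an equation in t, because the bound on the next one depends on
  the same t.\<close>

lemma bounded_coeffs:
  assumes hol: "\<phi> holomorphic_on ball 0 1" and le1: "\<And>z. z \<in> ball 0 1 \<Longrightarrow> cmod (\<phi> z) \<le> 1"
    and F: "\<phi> has_fps_expansion F"
  obtains t where "0 \<le> t" "t \<le> 1" "cmod (fps_nth F 0) \<le> 1"
    "cmod (fps_nth F 1) = (1 - (cmod (fps_nth F 0))\<^sup>2) * t"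
    "cmod (fps_nth F 2) \<le> (1 - (cmod (fps_nth F 0))\<^sup>2) * (1 - t\<^sup>2 + cmod (fps_nth F 0) * t\<^sup>2)"
proof -
  obtain \<omega> C where \<omega>: "\<omega> holomorphic_on ball 0 1" "\<And>z. z \<in> ball 0 1 \<Longrightarrow> cmod (\<omega> z) \<le> 1"
    "\<omega> has_fps_expansion C" and F0: "\<phi> 0 = fps_nth F 0"
    and FC: "F - fps_const (fps_nth F 0) = fps_X * C * (1 - fps_const (cnj (fps_nth F 0)) * F)"
    using schur_step_fps[OF hol le1 F] by blast
  obtain \<rho> R where \<rho>: "\<rho> holomorphic_on ball 0 1" "\<And>z. z \<in> ball 0 1 \<Longrightarrow> cmod (\<rho> z) \<le> 1"
    "\<rho> has_fps_expansion R" and C0: "\<omega> 0 = fps_nth C 0"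
    and CR: "C - fps_const (fps_nth C 0) = fps_X * R * (1 - fps_const (cnj (fps_nth C 0)) * C)"
    using schur_step_fps[OF \<omega>] by blast
  have unit: "1 - cnj z * z = of_real (1 - (cmod z)\<^sup>2)" for z
    using complex_norm_square[of z] by (simp add: mult.commute)
  have sq: "0 \<le> 1 - (cmod z)\<^sup>2" if "cmod z \<le> 1" for z
    using that by (simp add: power_le_one)
  define a where "a = fps_nth F 0"
  define t where "t = cmod (fps_nth C 0)"
  have a: "cmod a \<le> 1" using le1[of 0] F0 by (simp add: a_def)
  have t: "0 \<le> t" "t \<le> 1" using \<omega>(2)[of 0] C0 by (auto simp: t_def)
  have R0: "cmod (fps_nth R 0) \<le> 1"
    using \<rho>(2)[of 0] has_fps_expansion_imp_0_eq_fps_nth_0[OF \<rho>(3)] by simp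
  note coeff_simps = fps_mult_nth eval_nat_numeral sum.atLeast_Suc_atMost fps_X_def
  have F1: "fps_nth F 1 = fps_nth C 0 * (1 - cnj a * a)"
    using arg_cong[OF FC, of "\<lambda>F. fps_nth F 1"] by (simp add: coeff_simps a_def)
  have F2: "fps_nth F 2 = fps_nth C 1 * (1 - cnj a * a) - fps_nth C 0 * cnj a * fps_nth F 1"
    using arg_cong[OF FC, of "\<lambda>F. fps_nth F 2"] by (simp add: coeff_simps a_def algebra_simps)
  have C1: "fps_nth C 1 = fps_nth R 0 * (1 - cnj (fps_nth C 0) * fps_nth C 0)"
    using arg_cong[OF CR, of "\<lambda>F. fps_nth F 1"] by (simp add: coeff_simps)
  have C1_le: "cmod (fps_nth C 1) \<le> 1 - t\<^sup>2"
    unfolding C1 unit norm_mult norm_of_real t_def[symmetric]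
    using R0 sq[of "fps_nth C 0"] t by (simp add: mult_left_le_one_le t_def)
  have F1_norm: "cmod (fps_nth F 1) = (1 - (cmod a)\<^sup>2) * t"
    unfolding F1 unit norm_mult norm_of_real t_def using sq[OF a] by simp
  \<comment> \<open>Substituting the formula for \<open>fps_nth F 1\<close> pulls out the common
    factor 1 - |a|^2.\<close>
  have "fps_nth F 2 = of_real (1 - (cmod a)\<^sup>2) * (fps_nth C 1 - cnj a * (fps_nth C 0)\<^sup>2)"
    unfolding F2 F1 unit by (simp add: algebra_simps power2_eq_square)
  then have "cmod (fps_nth F 2) =
      (1 - (cmod a)\<^sup>2) * cmod (fps_nth C 1 - cnj a * (fps_nth C 0)\<^sup>2)"
    using sq[OF a] by (simp only: norm_mult norm_of_real abs_of_nonneg)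
  also have "cmod (fps_nth C 1 - cnj a * (fps_nth C 0)\<^sup>2) \<le> 1 - t\<^sup>2 + cmod a * t\<^sup>2"
    using norm_triangle_ineq4[of "fps_nth C 1" "cnj a * (fps_nth C 0)\<^sup>2"] C1_le
    by (simp add: norm_mult norm_power t_def)
  finally have "cmod (fps_nth F 2) \<le> (1 - (cmod a)\<^sup>2) * (1 - t\<^sup>2 + cmod a * t\<^sup>2)"
    using sq[OF a] by (simp add: mult_left_mono)
  with t a F1_norm show ?thesis
    by (intro that[of t]) (auto simp: a_def)
qed

text \<open>Since w(0) = 0, one Schur step gives w = z \<phi> with |\<phi>| \<le> 1, so the bounds
  for \<phi> hold for w with indices shifted by one.\<close>

lemma schwarz_coeffs:
  assumes hol: "w holomorphic_on ball 0 1" and w: "w ` ball 0 1 \<subseteq> ball 0 1" "w 0 = 0"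
    and W: "w has_fps_expansion W"
  obtains t where "0 \<le> t" "t \<le> 1" "cmod (fps_nth W 1) \<le> 1"
    "cmod (fps_nth W 2) = (1 - (cmod (fps_nth W 1))\<^sup>2) * t"
    "cmod (fps_nth W 3) \<le> (1 - (cmod (fps_nth W 1))\<^sup>2) * (1 - t\<^sup>2 + cmod (fps_nth W 1) * t\<^sup>2)"
proof -
  have "cmod (w z) \<le> 1" if "z \<in> ball 0 1" for z
    using w(1) that by (auto simp: image_subset_iff less_imp_le)
  then obtain \<phi> C where \<phi>: "\<phi> holomorphic_on ball 0 1" "\<And>z. z \<in> ball 0 1 \<Longrightarrow> cmod (\<phi> z) \<le> 1"
    "\<phi> has_fps_expansion C" and W0: "w 0 = fps_nth W 0"
    and WC: "W - fps_const (fps_nth W 0) = fps_X * C * (1 - fps_const (cnj (fps_nth W 0)) * W)"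
    using schur_step_fps[OF hol _ W] by blast
  have WX: "W = fps_X * C" using WC W0 w(2) by simp
  have "fps_nth W 1 = fps_nth C 0" "fps_nth W 2 = fps_nth C 1" "fps_nth W 3 = fps_nth C 2"
    unfolding WX by (simp_all add: eval_nat_numeral)
  then show ?thesis
    using bounded_coeffs[OF \<phi>] that by metis
qed

text \<open>One estimate serves both determinants: 3/128 and 3/512 are the larger of the two values
  that |p| and |q| take for f and for its inverse.\<close>

lemma hankel_form_bound:
  fixes b1 b2 b3 p q :: complex and t :: real
  assumes t: "0 \<le> t" "t \<le> 1" and b1: "cmod b1 \<le> 1"
    and b2: "cmod b2 = (1 - (cmod b1)\<^sup>2) * t"
    and b3: "cmod b3 \<le> (1 - (cmod b1)\<^sup>2) * (1 - t\<^sup>2 + cmod b1 * t\<^sup>2)"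
    and pq: "cmod p \<le> 3/128" "cmod q \<le> 3/512"
  shows "cmod (b1 * b3 / 32 + p * b1\<^sup>2 * b2 + q * b1 ^ 4 - b2\<^sup>2 / 16) \<le> 1/16"
proof -
  define c where "c = cmod b1"
  define u where "u = 1 - c\<^sup>2"
  have c: "0 \<le> c" "c \<le> 1" using b1 by (auto simp: c_def)
  have u: "0 \<le> u" using c by (simp add: u_def power_le_one)
  have t2: "t\<^sup>2 \<le> 1" "0 \<le> t\<^sup>2" using t by (auto simp: power_le_one)
  have "cmod (b1 * b3 / 32) \<le> c * (u * (1 - t\<^sup>2 + c * t\<^sup>2)) / 32"
    using mult_left_mono[OF b3 norm_ge_zero[of b1]] by (simp add: norm_mult norm_divide c_def u_def)
  moreover have "cmod (p * b1\<^sup>2 * b2) \<le> 3/128 * (c\<^sup>2 * (u * t))"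
    using mult_right_mono[OF pq(1), of "c\<^sup>2 * (u * t)"] u t b2
    by (simp add: norm_mult norm_power c_def u_def mult.assoc)
  moreover have "cmod (q * b1 ^ 4) \<le> 3/512 * c ^ 4"
    using mult_right_mono[OF pq(2), of "c ^ 4"] c by (simp add: norm_mult norm_power c_def)
  moreover have "cmod (b2\<^sup>2 / 16) = u\<^sup>2 * t\<^sup>2 / 16"
    using b2 by (simp add: norm_divide norm_power c_def u_def power_mult_distrib)
  moreover have "cmod (b1 * b3 / 32 + p * b1\<^sup>2 * b2 + q * b1 ^ 4 - b2\<^sup>2 / 16) \<le>
      cmod (b1 * b3 / 32) + cmod (p * b1\<^sup>2 * b2) + cmod (q * b1 ^ 4) + cmod (b2\<^sup>2 / 16)"
    by (smt (verit) norm_triangle_ineq norm_triangle_ineq4)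
  ultimately have "cmod (b1 * b3 / 32 + p * b1\<^sup>2 * b2 + q * b1 ^ 4 - b2\<^sup>2 / 16) \<le>
      c * (u * (1 - t\<^sup>2 + c * t\<^sup>2)) / 32 + 3/128 * (c\<^sup>2 * (u * t)) + 3/512 * c ^ 4 + u\<^sup>2 * t\<^sup>2 / 16"
    by linarith
  \<comment> \<open>With u = (1 - c)(1 + c) the coefficient of t^2 collects to u (1 - c)(2 + c)/32.
    All coefficients are now nonnegative, so t = 1 is the worst case.\<close>
  also have "\<dots> = (c * u + t\<^sup>2 * (u * (1 - c) * (2 + c))) / 32 + 3/128 * (c\<^sup>2 * (u * t)) + 3/512 * c ^ 4"
    by (simp add: u_def field_simps power2_eq_square)
  also have "\<dots> \<le> (c * u + 1 * (u * (1 - c) * (2 + c))) / 32 + 3/128 * (c\<^sup>2 * (u * 1)) + 3/512 * c ^ 4"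
    using c u t t2 by (intro add_mono mult_mono divide_right_mono) auto
  also have "\<dots> = 1/16 - c\<^sup>2 * (36 - 7 * c\<^sup>2) / 512"
    by (simp add: u_def field_simps power2_eq_square power4_eq_xxxx)
  also have "\<dots> \<le> 1/16"
    using c u by (simp add: u_def)
  finally show ?thesis .
qed

section \<open>The coefficients of \<open>f\<close> and of its inverse\<close>

text \<open>The coefficients follow recursively from S * S = 1 + W, where the principal branch fixes
  the constant term 1.\<close>

lemma csqrt_one_plus_schwarz_fps:
  assumes hol: "w holomorphic_on ball 0 1" and w: "w ` ball 0 1 \<subseteq> ball 0 1" "w 0 = 0"
    and W: "w has_fps_expansion W"
  obtains S where "(\<lambda>z. csqrt (1 + w z)) has_fps_expansion S" "fps_nth S 0 = 1"
    "fps_nth S 1 = fps_nth W 1 / 2"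
    "fps_nth S 2 = fps_nth W 2 / 2 - (fps_nth W 1)\<^sup>2 / 8"
    "fps_nth S 3 = fps_nth W 3 / 2 - fps_nth W 1 * fps_nth W 2 / 4 + (fps_nth W 1) ^ 3 / 16"
proof -
  define s where "s = (\<lambda>z. csqrt (1 + w z))"
  define S where "S = fps_expansion s 0"
  \<comment> \<open>Re(1 + w) > 0 keeps 1 + w off the branch cut, so the root is
    holomorphic.\<close>
  have nonneg: "1 + w z \<notin> \<real>\<^sub>\<le>\<^sub>0" if "z \<in> ball 0 1" for z
  proof -
    have "cmod (w z) < 1" using w(1) that by (auto simp: image_subset_iff)
    then have "Re (1 + w z) > 0" using abs_Re_le_cmod[of "w z"] by simp
    then show ?thesis by (auto simp: complex_nonpos_Reals_iff)
  qed
  have "s holomorphic_on ball 0 1"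
    unfolding s_def by (intro holomorphic_intros hol nonneg)
  then have S: "s has_fps_expansion S"
    unfolding S_def by (intro has_fps_expansion_fps_expansion[of "ball 0 1"]) auto
  have S0: "fps_nth S 0 = 1"
    using has_fps_expansion_imp_0_eq_fps_nth_0[OF S] w(2) by (simp add: s_def)
  have root: "s z * s z = 1 + w z" for z
    by (simp add: s_def flip: power2_eq_square)
  have "S * S = 1 + W"
  proof (rule has_fps_expansion_eqI)
    show "(\<lambda>z. s z * s z) has_fps_expansion S * S" "(\<lambda>z. 1 + w z) has_fps_expansion 1 + W"
      by (intro fps_expansion_intros S W)+
  qed (rule open_UNIV UNIV_I root)+
  then have eq: "fps_nth (S * S) n = fps_nth (1 + W) n" for n by simp
  note coeff_simps = fps_mult_nth eval_nat_numeral sum.atLeast_Suc_atMost S0[simplified]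
  have e1: "2 * fps_nth S 1 = fps_nth W 1"
    using eq[of 1] by (simp add: coeff_simps)
  have e2: "2 * fps_nth S 2 + (fps_nth S 1)\<^sup>2 = fps_nth W 2"
    using eq[of 2] by (simp add: coeff_simps algebra_simps)
  have e3: "2 * fps_nth S 3 + 2 * fps_nth S 1 * fps_nth S 2 = fps_nth W 3"
    using eq[of 3] by (simp add: coeff_simps algebra_simps)
  have s1: "fps_nth S 1 = fps_nth W 1 / 2"
    using e1 by (simp add: field_simps)
  have s2: "fps_nth S 2 = fps_nth W 2 / 2 - (fps_nth W 1)\<^sup>2 / 8"
    using e2 unfolding s1 by (simp add: field_simps power2_eq_square)
  have s3: "fps_nth S 3 = fps_nth W 3 / 2 - fps_nth W 1 * fps_nth W 2 / 4 + (fps_nth W 1) ^ 3 / 16"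
    using e3 unfolding s1 s2 by (simp add: field_simps power2_eq_square power3_eq_cube)
  show ?thesis
    using that[OF _ S0 s1 s2 s3] S by (simp add: s_def)
qed

lemma class_S_fps:
  assumes "f \<in> class_S"
  shows "f has_fps_expansion fps_expansion f 0"
    "fps_nth (fps_expansion f 0) 0 = 0" "fps_nth (fps_expansion f 0) 1 = 1"
proof -
  show "f has_fps_expansion fps_expansion f 0"
    using assms by (intro has_fps_expansion_fps_expansion[of "ball 0 1"]) (auto simp: class_S_def)
  show "fps_nth (fps_expansion f 0) 0 = 0" "fps_nth (fps_expansion f 0) 1 = 1"
    using assms by (auto simp: class_S_def fps_expansion_def)
qed

text \<open>Clear the denominator and compare coefficients. In f(z) - f(-z) only the odd
  coefficients survive, doubled, so each comparison is linear in the new coefficient of f.\<close>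

lemma class_SSL_coeffs:
  assumes f: "f \<in> class_S"
    and hol: "w holomorphic_on ball 0 1" and w: "w ` ball 0 1 \<subseteq> ball 0 1" "w 0 = 0"
    and W: "w has_fps_expansion W"
    and eq: "\<forall>z\<in>ball 0 1. sym_quotient f z = csqrt (1 + w z)"
  defines "F \<equiv> fps_expansion f 0"
  shows "fps_nth F 2 = fps_nth W 1 / 4"
    "fps_nth F 3 = fps_nth W 2 / 4 - (fps_nth W 1)\<^sup>2 / 16"
    "fps_nth F 4 = fps_nth W 3 / 8 - fps_nth W 1 * fps_nth W 2 / 32 + (fps_nth W 1) ^ 3 / 128"
proof -
  obtain S where S: "(\<lambda>z. csqrt (1 + w z)) has_fps_expansion S" "fps_nth S 0 = 1"
    and s1: "fps_nth S 1 = fps_nth W 1 / 2"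
    and s2: "fps_nth S 2 = fps_nth W 2 / 2 - (fps_nth W 1)\<^sup>2 / 8"
    and s3: "fps_nth S 3 = fps_nth W 3 / 2 - fps_nth W 1 * fps_nth W 2 / 4 + (fps_nth W 1) ^ 3 / 16"
    using csqrt_one_plus_schwarz_fps[OF hol w W] by blast
  note F = class_S_fps[OF f, folded F_def]
  have inj: "inj_on f (ball 0 1)" using f by (auto simp: class_S_def)
  \<comment> \<open>Injectivity makes the denominator nonzero away from 0; at 0 both sides
    vanish.\<close>
  have "2 * z * deriv f z = (f z - f (- z)) * csqrt (1 + w z)" if z: "z \<in> ball 0 1" for z
  proof (cases "z = 0")
    case False
    then have "f z \<noteq> f (- z)"
      using inj z by (auto dest: inj_onD)
    then show ?thesis
      using bspec[OF eq z] False by (simp add: sym_quotient_def field_simps)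
  qed simp
  moreover have "(f \<circ> uminus) has_fps_expansion fps_compose F (- fps_X)"
    by (intro fps_expansion_intros F) auto
  then have Fm: "(\<lambda>z. f (- z)) has_fps_expansion fps_compose F (- fps_X)"
    by (simp add: o_def)
  ultimately have "2 * fps_X * fps_deriv F = (F - fps_compose F (- fps_X)) * S"
    by (intro has_fps_expansion_eqI[of "\<lambda>z. 2 * z * deriv f z" _
          "\<lambda>z. (f z - f (- z)) * csqrt (1 + w z)" _ "ball 0 1"])
      (auto intro!: fps_expansion_intros F S)
  moreover have "fps_nth (2 * fps_X * fps_deriv F) (Suc n) = 2 * (of_nat (Suc n) * fps_nth F (Suc n))" for n
    by (simp add: mult.assoc numeral_fps_const)
  ultimately have eq: "2 * (of_nat (Suc n) * fps_nth F (Suc n)) =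
      fps_nth ((F - fps_compose F (- fps_X)) * S) (Suc n)" for n
    by metis
  note coeff_simps = fps_mult_nth fps_compose_uminus' eval_nat_numeral sum.atLeast_Suc_atMost
    S(2)[simplified] F(2,3)[simplified]
  have e2: "2 * fps_nth F 2 = fps_nth S 1"
    using eq[of 1] by (simp add: coeff_simps)
  have e3: "3 * fps_nth F 3 = fps_nth S 2 + fps_nth F 3"
    using eq[of 2] by (simp add: coeff_simps)
  have e4: "8 * fps_nth F 4 = 2 * fps_nth S 3 + 2 * fps_nth F 3 * fps_nth S 1"
    using eq[of 3] by (simp add: coeff_simps)
  show "fps_nth F 2 = fps_nth W 1 / 4"
    using e2 unfolding s1 by (simp add: field_simps)
  show f3: "fps_nth F 3 = fps_nth W 2 / 4 - (fps_nth W 1)\<^sup>2 / 16"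
    using e3 s2 by (simp add: field_simps)
  have "8 * fps_nth F 4 =
      8 * (fps_nth W 3 / 8 - fps_nth W 1 * fps_nth W 2 / 32 + (fps_nth W 1) ^ 3 / 128)"
    unfolding e4 f3 s1 s3 by (simp add: field_simps power2_eq_square power3_eq_cube)
  then show "fps_nth F 4 = fps_nth W 3 / 8 - fps_nth W 1 * fps_nth W 2 / 32 + (fps_nth W 1) ^ 3 / 128"
    by (simp only: mult_cancel_left) simp
qed

text \<open>Comparing coefficients in G(F(X)) = X is a triangular system, because F starts with X:
  the n-th equation determines the n-th coefficient of G.\<close>

lemma disc_inv_coeffs:
  assumes f: "f \<in> class_S"
  defines "F \<equiv> fps_expansion f 0" and "G \<equiv> fps_expansion (disc_inv f) 0"
  shows "fps_nth G 2 = - fps_nth F 2"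
    "fps_nth G 3 = 2 * (fps_nth F 2)\<^sup>2 - fps_nth F 3"
    "fps_nth G 4 = 5 * fps_nth F 2 * fps_nth F 3 - 5 * (fps_nth F 2) ^ 3 - fps_nth F 4"
proof -
  note F = class_S_fps[OF f, folded F_def]
  have hol: "f holomorphic_on ball 0 1" and inj: "inj_on f (ball 0 1)" and f0: "f 0 = 0"
    using f by (auto simp: class_S_def)
  have inv: "disc_inv f (f z) = z" if "z \<in> ball 0 1" for z
    using the_inv_into_f_f[OF inj that] by (simp add: disc_inv_def)
  \<comment> \<open>\<open>disc_inv f\<close> agrees on the image with a holomorphic inverse, hence
    is itself holomorphic there.\<close>
  obtain g where g: "g holomorphic_on f ` ball 0 1" "\<And>z. z \<in> ball 0 1 \<Longrightarrow> g (f z) = z"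
    using holomorphic_has_inverse[OF hol open_ball inj] by metis
  have "disc_inv f holomorphic_on f ` ball 0 1"
    using g(1) by (rule holomorphic_transform) (auto simp: g(2) inv)
  moreover have "open (f ` ball 0 1)"
    using open_mapping_thm3[OF hol open_ball inj] .
  moreover have "0 \<in> f ` ball 0 1"
    using f0 by force
  ultimately have G: "disc_inv f has_fps_expansion G"
    unfolding G_def by (intro has_fps_expansion_fps_expansion)
  have "fps_compose G F = fps_X"
    by (rule has_fps_expansion_eqI[of "disc_inv f \<circ> f" _ "\<lambda>z. z" _ "ball 0 1"])
      (use inv in \<open>auto intro!: fps_expansion_intros G F\<close>)
  then have eq: "fps_nth (fps_compose G F) n = fps_nth fps_X n" for n by simp
  note coeff_simps = fps_compose_nth fps_mult_nth eval_nat_numeral sum.atLeast_Suc_atMost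
    F(2,3)[simplified]
  have e1: "fps_nth G 1 = 1"
    using eq[of 1] by (simp add: coeff_simps)
  have e2: "fps_nth F 2 + fps_nth G 2 = 0"
    using eq[of 2] e1 by (simp add: coeff_simps)
  have e3: "fps_nth F 3 + 2 * fps_nth G 2 * fps_nth F 2 + fps_nth G 3 = 0"
    using eq[of 3] e1 by (simp add: coeff_simps algebra_simps)
  have e4: "fps_nth F 4 + fps_nth G 2 * (2 * fps_nth F 3 + (fps_nth F 2)\<^sup>2)
      + 3 * fps_nth G 3 * fps_nth F 2 + fps_nth G 4 = 0"
    using eq[of 4] e1 by (simp add: coeff_simps algebra_simps)
  show g2: "fps_nth G 2 = - fps_nth F 2"
    using e2 by (simp add: add_eq_0_iff2)
  show g3: "fps_nth G 3 = 2 * (fps_nth F 2)\<^sup>2 - fps_nth F 3"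
    using e3 unfolding g2 by algebra
  show "fps_nth G 4 = 5 * fps_nth F 2 * fps_nth F 3 - 5 * (fps_nth F 2) ^ 3 - fps_nth F 4"
    using e4 unfolding g2 g3 by algebra
qed

text \<open>The second determinant is the first plus a_2^2 (a_2^2 - a_3), which changes only the
  coefficients of b_1^2 b_2 and b_1^4. The sum is written with \<open>+ (- 1/512) *\<close> to match
  the pattern of \<open>hankel_form_bound\<close>.\<close>

lemma class_SSL_hankel:
  assumes f: "f \<in> class_S"
    and hol: "w holomorphic_on ball 0 1" and w: "w ` ball 0 1 \<subseteq> ball 0 1" "w 0 = 0"
    and W: "w has_fps_expansion W"
    and eq: "\<forall>z\<in>ball 0 1. sym_quotient f z = csqrt (1 + w z)"
  shows "hankel22 f = fps_nth W 1 * fps_nth W 3 / 32 + 3/128 * (fps_nth W 1)\<^sup>2 * fps_nth W 2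
      + (- 1/512) * fps_nth W 1 ^ 4 - (fps_nth W 2)\<^sup>2 / 16" (is ?H)
    and "hankel22 (disc_inv f) = fps_nth W 1 * fps_nth W 3 / 32
      + 1/128 * (fps_nth W 1)\<^sup>2 * fps_nth W 2 + 3/512 * fps_nth W 1 ^ 4 - (fps_nth W 2)\<^sup>2 / 16" (is ?I)
proof -
  note coeffs = class_SSL_coeffs[OF assms]
  show ?H
    unfolding hankel22_def Let_def coeffs
    by (simp add: field_simps power2_eq_square power3_eq_cube power4_eq_xxxx)
  show ?I
    unfolding hankel22_def Let_def disc_inv_coeffs[OF f] coeffs
    by (simp add: field_simps power2_eq_square power3_eq_cube power4_eq_xxxx)
qed

section \<open>The extremal function\<close>

text \<open>The Noshiro-Warschawski criterion. If f(x) = f(y), the mean value theorem for the real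
  part of f/(y - x) along the segment gives a point with Re f' = 0.\<close>

lemma inj_on_Re_deriv_pos:
  fixes f :: "complex \<Rightarrow> complex"
  assumes "convex A" and deriv: "\<And>z. z \<in> A \<Longrightarrow> (f has_field_derivative f' z) (at z)"
    and pos: "\<And>z. z \<in> A \<Longrightarrow> Re (f' z) > 0"
  shows "inj_on f A"
proof (rule inj_onI, rule ccontr)
  fix x y assume xy: "x \<in> A" "y \<in> A" "f x = f y" "x \<noteq> y"
  have sub: "closed_segment x y \<subseteq> A"
    using xy \<open>convex A\<close> by (simp add: closed_segment_subset)
  have "((\<lambda>z. f z / (y - x)) has_field_derivative f' u / (y - x)) (at u)"
    if "u \<in> closed_segment x y" for u
    using deriv sub that by (intro DERIV_cdivide) auto
  from complex_mvt_line[OF this] obtain u where "u \<in> closed_segment x y"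
    "Re (f y / (y - x)) - Re (f x / (y - x)) = Re (f' u / (y - x) * (y - x))"
    by blast
  then show False
    using xy pos[of u] sub by auto
qed

text \<open>Closed form of z exp(\<integral> (s - 1)/\<zeta> d\<zeta>) with s = \<surd>(1 +
  \<zeta>^2), the integral running from 0 to z: an antiderivative is s - 1 - log((1 + s)/2), which
  vanishes at 0.\<close>

definition extremal :: "complex \<Rightarrow> complex" where
  "extremal z = 2 * z * exp (csqrt (1 + z\<^sup>2) - 1) / (1 + csqrt (1 + z\<^sup>2))"

text \<open>Locates s for the positivity argument. Re s^2 > 0 gives |Im s| < Re s, and with |s|^2 <
  2 this forces |Im s| \<le> 1.\<close>

lemma csqrt_one_plus_square:
  assumes "z \<in> ball 0 1"
  defines "s \<equiv> csqrt (1 + z\<^sup>2)"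
  shows "1 + z\<^sup>2 \<notin> \<real>\<^sub>\<le>\<^sub>0" "s\<^sup>2 = 1 + z\<^sup>2" "0 < Re s" "\<bar>Im s\<bar> \<le> 1" "\<bar>Im s\<bar> \<le> Re s"
proof -
  have z2: "cmod (z\<^sup>2) < 1"
    using assms(1) by (simp add: norm_power power_less_one_iff)
  then have re: "Re (1 + z\<^sup>2) > 0"
    using abs_Re_le_cmod[of "z\<^sup>2"] by (simp del: Re_power2)
  then show "1 + z\<^sup>2 \<notin> \<real>\<^sub>\<le>\<^sub>0"
    by (simp add: complex_nonpos_Reals_iff)
  show s2: "s\<^sup>2 = 1 + z\<^sup>2" by (simp add: s_def)
  have ri: "(Re s)\<^sup>2 - (Im s)\<^sup>2 > 0"
    using re unfolding s2[symmetric] by (simp add: Re_power2)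
  then have "Re s \<noteq> 0" by (auto simp: not_less)
  then show pos: "0 < Re s" using Re_csqrt[of "1 + z\<^sup>2"] by (simp add: s_def order_less_le)
  show "\<bar>Im s\<bar> \<le> Re s"
    using ri pos by (intro power2_le_imp_le[of "\<bar>Im s\<bar>"]) auto
  have "(cmod s)\<^sup>2 = cmod (1 + z\<^sup>2)" by (simp flip: s2 norm_power)
  also have "\<dots> < 2" using norm_triangle_ineq[of 1 "z\<^sup>2"] z2 by simp
  finally have "(Re s)\<^sup>2 + (Im s)\<^sup>2 < 2" by (simp add: cmod_power2)
  with ri have "(Im s)\<^sup>2 \<le> 1" by simp
  then show "\<bar>Im s\<bar> \<le> 1" by (simp add: abs_square_le_1)
qed

text \<open>The derivative is s f/z with the factor z cancelled, so that the formula also holds at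
  0.\<close>

lemma extremal_deriv:
  assumes z: "z \<in> ball 0 1"
  defines "s \<equiv> csqrt (1 + z\<^sup>2)"
  shows "(extremal has_field_derivative 2 * s * exp (s - 1) / (1 + s)) (at z)"
proof -
  note s = csqrt_one_plus_square[OF z, folded s_def]
  have nz: "s \<noteq> 0" "1 + s \<noteq> 0"
    using s(3) by (auto simp: complex_eq_iff)
  have "((\<lambda>z. csqrt (1 + z\<^sup>2)) has_field_derivative z / s) (at z)"
    using s(1) nz by (auto intro!: derivative_eq_intros simp: s_def field_simps)
  then have "(extremal has_field_derivative
      ((2 * exp (s - 1) + 2 * z * (exp (s - 1) * (z / s))) * (1 + s)
        - 2 * z * exp (s - 1) * (z / s)) / ((1 + s) * (1 + s))) (at z)"
    unfolding extremal_def[abs_def] using nz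
    by (auto intro!: derivative_eq_intros simp: s_def s(1)[unfolded s_def] simp del: csqrt.simps)
  also have "(2 * exp (s - 1) + 2 * z * (exp (s - 1) * (z / s))) * (1 + s)
      - 2 * z * exp (s - 1) * (z / s) = 2 * exp (s - 1) * ((1 + s) + z\<^sup>2)"
    using nz(1) by (simp add: field_simps power2_eq_square)
  also have "\<dots> / ((1 + s) * (1 + s)) = 2 * s * exp (s - 1) / (1 + s)"
  proof -
    \<comment> \<open>This is where s^2 = 1 + z^2 enters; it cancels one factor 1 + s.\<close>
    have "(1 + s) + z\<^sup>2 = s * (1 + s)" using s(2) by algebra
    then show ?thesis using nz by simp
  qed
  finally show ?thesis .
qed

text \<open>Multiplying by the conjugate of 1 + s reduces the sign to that of |s|^2 cos v - v sin v
  + u cos v. The first term dominates the second and the last is positive.\<close>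

lemma Re_mult_exp_div_pos:
  assumes "0 < Re s" "\<bar>Im s\<bar> \<le> 1" "\<bar>Im s\<bar> \<le> Re s"
  shows "0 < Re (2 * s * exp (s - 1) / (1 + s))"
proof -
  define u v where "u = Re s" and "v = Im s"
  have nz: "1 + s \<noteq> 0" using assms by (auto simp: complex_eq_iff)
  have v2: "v\<^sup>2 \<le> 1" "v\<^sup>2 \<le> u\<^sup>2"
    using assms power_mono[OF assms(3), of 2] by (auto simp: u_def v_def abs_square_le_1)
  \<comment> \<open>cos v = 1 - 2 sin^2(v/2) \<ge> 1 - v^2/2 \<ge> 1/2.\<close>
  have "(sin (v / 2))\<^sup>2 \<le> (v / 2)\<^sup>2"
    using abs_sin_x_le_abs_x[of "v / 2"] by (simp only: abs_le_square_iff)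
  then have cos: "1/2 \<le> cos v"
    using cos_double_sin[of "v / 2"] v2(1) by (simp add: power_divide)
  have "v * sin v \<le> \<bar>v\<bar> * \<bar>v\<bar>"
    using mult_left_mono[OF abs_sin_x_le_abs_x[of v], of "\<bar>v\<bar>"] abs_ge_self[of "v * sin v"]
    by (simp add: abs_mult)
  \<comment> \<open>|v| \<le> u gives v^2 \<le> (u^2 + v^2)/2, and the factor 1/2 is then absorbed
    by cos v.\<close>
  also have "\<dots> \<le> (u\<^sup>2 + v\<^sup>2) * (1/2)" using v2(2) by (simp flip: power2_eq_square)
  also have "\<dots> \<le> (u\<^sup>2 + v\<^sup>2) * cos v" using cos by (intro mult_left_mono) auto
  finally have "0 < (u\<^sup>2 + v\<^sup>2) * cos v - v * sin v + u * cos v"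
    using assms(1) cos by (simp add: u_def add_nonneg_pos)
  then have "0 < 2 * exp (u - 1) / (cmod (1 + s))\<^sup>2 * ((u\<^sup>2 + v\<^sup>2) * cos v - v * sin v + u * cos v)"
    using nz by (intro mult_pos_pos) auto
  also have "2 * s * exp (s - 1) / (1 + s)
      = of_real (2 * exp (u - 1) / (cmod (1 + s))\<^sup>2) * (s * (1 + cnj s) * cis v)"
  proof -
    have "exp (s - 1) = of_real (exp (u - 1)) * cis v"
      by (simp add: exp_eq_polar u_def v_def exp_of_real)
    moreover have "of_real ((cmod (1 + s))\<^sup>2) = (1 + s) * (1 + cnj s)"
      by (simp only: complex_norm_square complex_cnj_add complex_cnj_one)
    moreover have "1 + cnj s \<noteq> 0"
      using nz by (metis complex_cnj_add complex_cnj_one complex_cnj_zero_iff)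
    ultimately show ?thesis
      using nz by (simp add: divide_simps mult_ac del: of_real_power)
  qed
  moreover have "Re (s * (1 + cnj s) * cis v) = (u\<^sup>2 + v\<^sup>2) * cos v - v * sin v + u * cos v"
    by (simp add: u_def v_def algebra_simps power2_eq_square)
  ultimately show ?thesis by simp
qed

lemma extremal_class_S: "extremal \<in> class_S"
proof -
  have hol: "extremal holomorphic_on ball 0 1"
    by (rule holomorphic_onI)
      (meson extremal_deriv field_differentiable_def field_differentiable_at_within)
  have "inj_on extremal (ball 0 1)"
    by (rule inj_on_Re_deriv_pos[OF convex_ball extremal_deriv])
      (use csqrt_one_plus_square(3-5) Re_mult_exp_div_pos in blast)+
  moreover have "deriv extremal 0 = 1"
    using DERIV_imp_deriv[OF extremal_deriv[of 0]] by simp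
  ultimately show ?thesis
    using hol by (simp add: class_S_def extremal_def)
qed

text \<open>The function is odd, so f(z) - f(-z) = 2 f(z) and the quotient reduces to z f'/f =
  s.\<close>

lemma sym_quotient_extremal:
  shows "\<forall>z\<in>ball 0 1. sym_quotient extremal z = csqrt (1 + z\<^sup>2)"
proof
  fix z :: complex assume z: "z \<in> ball 0 1"
  show "sym_quotient extremal z = csqrt (1 + z\<^sup>2)"
  proof (cases "z = 0")
    case False
    note s = csqrt_one_plus_square[OF z]
    have "1 + csqrt (1 + z\<^sup>2) \<noteq> 0"
      using s(3) by (auto simp: complex_eq_iff simp del: csqrt.simps)
    moreover have "deriv extremal z
        = 2 * csqrt (1 + z\<^sup>2) * exp (csqrt (1 + z\<^sup>2) - 1) / (1 + csqrt (1 + z\<^sup>2))"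
      by (rule DERIV_imp_deriv[OF extremal_deriv[OF z]])
    moreover have "extremal (- z) = - extremal z"
      by (simp add: extremal_def)
    ultimately show ?thesis
      using False by (simp add: sym_quotient_def extremal_def del: csqrt.simps)
  qed (simp add: sym_quotient_def)
qed

theorem theorem2p12:
  shows "(\<forall>f\<in>class_SSL. cmod (hankel22 f) \<le> 1/16 \<and> cmod (hankel22 (disc_inv f)) \<le> 1/16)
       \<and> (\<exists>f\<in>class_SSL. cmod (hankel22 f) = 1/16)
       \<and> (\<exists>f\<in>class_SSL. cmod (hankel22 (disc_inv f)) = 1/16)"
proof (intro conjI)
  show "\<forall>f\<in>class_SSL. cmod (hankel22 f) \<le> 1/16 \<and> cmod (hankel22 (disc_inv f)) \<le> 1/16"
  proof
    fix f assume "f \<in> class_SSL"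
    then obtain w where f: "f \<in> class_S" and hol: "w holomorphic_on ball 0 1"
      and w: "w ` ball 0 1 \<subseteq> ball 0 1" "w 0 = 0"
      and eq: "\<forall>z\<in>ball 0 1. sym_quotient f z = csqrt (1 + w z)"
      unfolding class_SSL_def subordinate_def by blast
    have W: "w has_fps_expansion fps_expansion w 0"
      using hol by (intro has_fps_expansion_fps_expansion[of "ball 0 1"]) auto
    obtain t where t: "0 \<le> t" "t \<le> 1" "cmod (fps_nth (fps_expansion w 0) 1) \<le> 1"
      "cmod (fps_nth (fps_expansion w 0) 2) = (1 - (cmod (fps_nth (fps_expansion w 0) 1))\<^sup>2) * t"
      "cmod (fps_nth (fps_expansion w 0) 3) \<le> (1 - (cmod (fps_nth (fps_expansion w 0) 1))\<^sup>2)
        * (1 - t\<^sup>2 + cmod (fps_nth (fps_expansion w 0) 1) * t\<^sup>2)"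
      using schwarz_coeffs[OF hol w W] by blast
    show "cmod (hankel22 f) \<le> 1/16 \<and> cmod (hankel22 (disc_inv f)) \<le> 1/16"
      \<comment> \<open>After unfolding, p and q are read off by unification; only the numerical
        bounds on their moduli remain.\<close>
      unfolding class_SSL_hankel[OF f hol w W eq]
      by (intro conjI hankel_form_bound[OF t]) (simp_all add: norm_divide)
  qed
  have square: "(\<lambda>z. z\<^sup>2) holomorphic_on ball 0 1" "(\<lambda>z. z\<^sup>2) ` ball 0 1 \<subseteq> ball (0 :: complex) 1"
    by (auto intro!: holomorphic_intros simp: norm_power power_less_one_iff)
  have mem: "extremal \<in> class_SSL"
    unfolding class_SSL_def subordinate_def
    using extremal_class_S sym_quotient_extremal square by (auto intro!: exI[of _ "\<lambda>z. z\<^sup>2"])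
  have "(\<lambda>z::complex. z\<^sup>2) has_fps_expansion fps_X\<^sup>2"
    by (intro fps_expansion_intros)
  \<comment> \<open>For w = z^2 only b_2 = 1 is nonzero, so both determinants equal -1/16.\<close>
  note hankel = class_SSL_hankel[OF extremal_class_S square _ this sym_quotient_extremal]
  show "\<exists>f\<in>class_SSL. cmod (hankel22 f) = 1/16"
    using mem hankel(1) by (intro bexI[of _ extremal]) (auto simp: norm_divide)
  show "\<exists>f\<in>class_SSL. cmod (hankel22 (disc_inv f)) = 1/16"
    using mem hankel(2) by (intro bexI[of _ extremal]) (auto simp: norm_divide)
qed

end
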